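(* Let $\omega$ be a random variable uniformly distributed on the unit circle $\{|z|=1\}\subset\mathbb{C}$. Then for every integer $n\geq 0$, $$\lim_{k\to\infty}\mathbb{E}\,\Big|\frac{P_k(\omega)}{\sqrt{2^{k+1}}}\Big|^{2n}=\frac{1}{n+1},$$ and for all $0\le\alpha<\beta\le1$, $$\lim_{k\to\infty}\mathbb{P}\Big(\Big|\frac{P_k(\omega)}{\sqrt{2^{k+1}}}\Big|^2\in[\alpha,\beta]\Big)=\beta-\alpha.$$
   Context: The Rudin–Shapiro polynomials are defined by $P_0(z)=Q_0(z)=1$ and, for $k\ge0$, $P_{k+1}(z)=P_k(z)+z^{2^k}Q_k(z)$, $Q_{k+1}(z)=P_k(z)-z^{2^k}Q_k(z)$. They have degree $2^k-1$ and all coefficients in $\{1,-1\}$. *)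

theory Defs
  imports "HOL-Probability.Probability" "HOL-Computational_Algebra.Polynomial"
begin

fun RS :: "nat \<Rightarrow> complex poly \<times> complex poly" where
  "RS 0 = (1, 1)"
| "RS (Suc k) = (let (p, q) = RS k in
      (p + monom 1 (2 ^ k) * q, p - monom 1 (2 ^ k) * q))"

definition RS_P :: "nat \<Rightarrow> complex poly" where
  "RS_P k = fst (RS k)"

definition RS_Q :: "nat \<Rightarrow> complex poly" where
  "RS_Q k = snd (RS k)"

definition circle_measure :: "complex measure" where
  "circle_measure = distr (uniform_measure lborel {0..<1::real}) borel
                          (\<lambda>t. cis (2 * pi * t))"

end

theory Submission
  imports Defs "Jordan_Normal_Form.Spectral_Radius"
begin

text \<open>
  Normalise \<open>p = P\<^sub>k / \<surd>2\<^bsup>k+1\<^esup>\<close>, \<open>q = Q\<^sub>k / \<surd>2\<^bsup>k+1\<^esup>\<close>, so that \<open>\<bar>p\<bar>\<^sup>2 + \<bar>q\<bar>\<^sup>2 = 1\<close> on the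
  circle. The middle coefficient of the form \<open>(p s + q)\<^sup>m (-q\<^sup>* s + p\<^sup>*)\<^sup>m\<close> of degree \<open>n = 2m\<close> in \<open>s\<close> (with
  \<open>*\<close> denoting conjugation) is the shifted Legendre polynomial of degree \<open>m\<close> evaluated at \<open>\<bar>p\<bar>\<^sup>2\<close>, so it
  suffices that its mean tends to 0 for \<open>m \<ge> 1\<close>. Under the Rudin-Shapiro recursion the form is
  transformed by a monomial change of variable and a Hadamard matrix, that is, by the Krawtchouk
  matrix \<open>K\<close> of size \<open>n + 1\<close>. Only the Fourier coefficients of the form at the frequencies
  \<open>2\<^sup>k (h - m)\<close>, \<open>0 \<le> h \<le> n\<close>, matter, and these satisfy one fixed finite linear recurrence
  \<open>x(h, l) \<mapsto> \<tau> \<Sum>\<^sub>j K(j, l) x(2h - j, j)\<close> with \<open>\<bar>\<tau>\<bar> = 2\<^bsup>-m\<^esup>\<close>.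

  The recurrence has spectral radius less than 1. It is a contraction for the norm with weights
  \<open>1 / (n choose l)\<close>, so an eigenvector \<open>x\<close> with \<open>\<bar>\<mu>\<bar> \<ge> 1\<close> must vanish at all \<open>(h, l)\<close> with \<open>h + l\<close> odd.
  If \<open>D\<close> is the largest \<open>h\<close> with \<open>x(h, \<cdot>) \<noteq> 0\<close>, then \<open>\<Sum>\<^sub>l x(D, l) s\<^sup>l\<close> is divisible by
  \<open>(s + 1)\<^sup>D\<close> and, since \<open>K\<close> is an involution up to scaling, has degree at most \<open>D\<close>. So it equals
  \<open>c (s + 1)\<^sup>D\<close>, which contradicts the parity condition if \<open>D \<ge> 1\<close> and \<open>\<bar>\<mu>\<bar> \<ge> 1\<close> if \<open>D = 0\<close>.
  Convergence of the Legendre means gives convergence of all moments, and then weak convergence.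
\<close>

section \<open>Linear recurrences without eigenvalues outside the open unit disc\<close>

text \<open>Iterating the recurrence applies powers of one matrix \<open>A\<close>, all of whose
  eigenvalues have modulus below 1 by \<open>eig\<close>. A spectral radius below 1 gives bounded
  powers; dividing \<open>A\<close> first by some \<open>c < 1\<close> above its spectral radius
  turns boundedness into decay like \<open>c ^ k\<close>.\<close>

lemma linear_recurrence_tendsto_0:
  fixes a :: "'i \<Rightarrow> 'i \<Rightarrow> complex" and x :: "nat \<Rightarrow> 'i \<Rightarrow> complex"
  assumes fin: "finite I" and "i \<in> I"
    and rec: "\<And>k i. i \<in> I \<Longrightarrow> x (Suc k) i = (\<Sum>j\<in>I. a i j * x k j)"
    and eig: "\<And>y l i. (\<And>i. i \<in> I \<Longrightarrow> l * y i = (\<Sum>j\<in>I. a i j * y j)) \<Longrightarrow> 1 \<le> cmod l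
               \<Longrightarrow> i \<in> I \<Longrightarrow> y i = 0"
  shows "(\<lambda>k. x k i) \<longlonglongrightarrow> 0"
proof -
  define n where "n = card I"
  have n: "n > 0"
    using fin \<open>i \<in> I\<close> by (auto simp: n_def card_gt_0_iff)
  obtain e where e: "bij_betw e {..<n} I"
    using ex_bij_betw_nat_finite[OF fin] by (auto simp: n_def atLeast0LessThan)
  have eI: "e p \<in> I" if "p < n" for p
    using e that by (auto simp: bij_betw_def)
  have sum_e: "(\<Sum>j\<in>I. f j) = (\<Sum>q<n. f (e q))" for f :: "'i \<Rightarrow> complex"
    using sum.reindex_bij_betw[OF e, of f] by simp
  define A where "A = Matrix.mat n n (\<lambda>(p, q). a (e p) (e q))"
  have A: "A \<in> carrier_mat n n" and dA: "dim_row A = n"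
    by (auto simp: A_def)
  have A_mult: "vec_index (A *\<^sub>v v) p = (\<Sum>q<n. a (e p) (e q) * vec_index v q)"
    if "p < n" "dim_vec v = n" for p v
    using that by (simp add: A_def scalar_prod_def atLeast0LessThan)
  have ev: "cmod l < 1" if l: "eigenvalue A l" for l
  proof (rule ccontr)
    assume "\<not> cmod l < 1"
    obtain v where v: "dim_vec v = n" "v \<noteq> 0\<^sub>v n" "A *\<^sub>v v = l \<cdot>\<^sub>v v"
      using l unfolding eigenvalue_def eigenvector_def dA carrier_vec_def by blast
    define y where "y = (\<lambda>i. vec_index v (the_inv_into {..<n} e i))"
    have y: "y (e p) = vec_index v p" if "p < n" for p
      using that e by (simp add: y_def the_inv_into_f_f bij_betw_def)
    have "y j = 0" if "j \<in> I" for j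
    proof (rule eig[OF _ _ that])
      show "1 \<le> cmod l" using \<open>\<not> cmod l < 1\<close> by simp
      fix i assume "i \<in> I"
      then obtain p where p: "p < n" "i = e p"
        using e by (auto simp: bij_betw_def)
      have "l * y i = vec_index (l \<cdot>\<^sub>v v) p"
        using p v by (simp add: y)
      also have "\<dots> = (\<Sum>q<n. a (e p) (e q) * vec_index v q)"
        using A_mult[OF p(1) v(1)] v(3) by simp
      also have "\<dots> = (\<Sum>j\<in>I. a i j * y j)"
        using p y by (simp add: sum_e)
      finally show "l * y i = (\<Sum>j\<in>I. a i j * y j)" .
    qed
    then have "vec_index v p = 0" if "p < n" for p
      using y[OF that] eI[OF that] by simp
    then have "v = 0\<^sub>v n" using v(1) by (intro eq_vecI) auto
    with v show False by simp
  qed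
  define r where "r = spectral_radius A"
  have r: "r < 1" "0 \<le> r"
    using spectral_radius_mem_max(1)[OF A n] ev by (auto simp: r_def spectrum_def)
  define c where "c = (1 + r) / 2"
  have c: "0 < c" "c < 1" "r < c" using r by (auto simp: c_def)
  define B where "B = (1 / complex_of_real c) \<cdot>\<^sub>m A"
  have B: "B \<in> carrier_mat n n" using A by (simp add: B_def)
  have "spectral_radius B < 1"
  proof -
    obtain l where l: "eigenvalue B l" "spectral_radius B = cmod l"
      using spectral_radius_mem_max(1)[OF B n] by (auto simp: spectrum_def)
    obtain v where v: "v \<in> carrier_vec n" "v \<noteq> 0\<^sub>v n" "B *\<^sub>v v = l \<cdot>\<^sub>v v"
      using l B unfolding eigenvalue_def eigenvector_def by auto
    have "A *\<^sub>v v = complex_of_real c \<cdot>\<^sub>v (B *\<^sub>v v)"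
      using v(1) A c by (auto simp: B_def intro!: eq_vecI)
    also have "\<dots> = (complex_of_real c * l) \<cdot>\<^sub>v v"
      using v by (simp add: smult_smult_assoc)
    finally have "eigenvalue A (complex_of_real c * l)"
      using v A unfolding eigenvalue_def eigenvector_def by auto
    then have "cmod (complex_of_real c * l) \<in> cmod ` spectrum A"
      unfolding spectrum_def by blast
    then have "cmod (complex_of_real c * l) \<le> r"
      using spectral_radius_mem_max(2)[OF A n] r_def by blast
    then have "c * cmod l \<le> r" using c by (simp add: norm_mult)
    then have "c * cmod l < c * 1" using c by linarith
    then have "cmod l < 1" using c by simp
    with l show ?thesis by simp
  qed
  then obtain C where C: "\<And>k. norm_bound (B ^\<^sub>m k) C"
    using spectral_radius_jnf_norm_bound_less_1_upper_triangular[OF B] by blast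
  define u where "u = Matrix.vec n (\<lambda>p. x 0 (e p))"
  have u: "u \<in> carrier_vec n" by (simp add: u_def)
  have Bk: "B ^\<^sub>m k \<in> carrier_mat n n" for k using B by simp
  \<comment> \<open>Matrix powers append the new factor on the right, but the recurrence applies it
    on the left.\<close>
  have comm: "B ^\<^sub>m k * B = B * B ^\<^sub>m k" for k
  proof (induction k)
    case 0
    then show ?case using B by simp
  next
    case (Suc k)
    then show ?case using assoc_mult_mat[OF B Bk B] by simp
  qed
  have xk: "complex_of_real c ^ k * vec_index (B ^\<^sub>m k *\<^sub>v u) p = x k (e p)" if "p < n" for k p
    using that
  proof (induction k arbitrary: p)
    case 0
    then show ?case using B by (simp add: u_def)
  next
    case (Suc k)
    define w where "w = B ^\<^sub>m k *\<^sub>v u"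
    have w: "dim_vec w = n" using B by (simp add: w_def)
    have "B ^\<^sub>m Suc k *\<^sub>v u = B *\<^sub>v w"
      using assoc_mult_mat_vec[OF B Bk u] by (simp add: w_def comm)
    also have "\<dots> = (1 / complex_of_real c) \<cdot>\<^sub>v (A *\<^sub>v w)"
      using w A by (auto simp: B_def intro!: eq_vecI)
    finally have "vec_index (B ^\<^sub>m Suc k *\<^sub>v u) p
                    = (1 / complex_of_real c) * (\<Sum>q<n. a (e p) (e q) * vec_index w q)"
      using A_mult[OF Suc.prems w] Suc.prems A by simp
    then have "complex_of_real c ^ Suc k * vec_index (B ^\<^sub>m Suc k *\<^sub>v u) p
                = (\<Sum>q<n. a (e p) (e q) * (complex_of_real c ^ k * vec_index w q))"
      using c by (simp add: sum_distrib_left mult_ac)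
    also have "\<dots> = (\<Sum>q<n. a (e p) (e q) * x k (e q))"
      using Suc.IH by (simp add: w_def)
    also have "\<dots> = x (Suc k) (e p)"
      using rec[OF eI[OF Suc.prems]] by (simp add: sum_e)
    finally show ?case .
  qed
  obtain p where p: "p < n" "i = e p" 
    using e \<open>i \<in> I\<close> by (auto simp: bij_betw_def)
  define K where "K = (\<Sum>q<n. C * cmod (x 0 (e q)))"
  have "norm (x k i) \<le> c ^ k * K" for k
  proof -
    have "vec_index (M *\<^sub>v u) p = (\<Sum>q<n. M $$ (p, q) * x 0 (e q))"
      if "M \<in> carrier_mat n n" for M
      using that p by (simp add: scalar_prod_def u_def atLeast0LessThan)
    from this[OF Bk]
    have "vec_index (B ^\<^sub>m k *\<^sub>v u) p = (\<Sum>q<n. (B ^\<^sub>m k) $$ (p, q) * x 0 (e q))" .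
    also have "cmod \<dots> \<le> K"
      unfolding K_def using C[of k] B p
      by (intro sum_norm_le) (auto simp: norm_mult norm_bound_def intro!: mult_right_mono)
    finally show ?thesis
      using xk[OF p(1), of k, symmetric] p(2) c by (simp add: norm_mult norm_power)
  qed
  then have "\<forall>\<^sub>F k in sequentially. norm (x k i) \<le> c ^ k * K"
    by (intro always_eventually allI)
  moreover have "(\<lambda>k. c ^ k * K) \<longlonglongrightarrow> 0"
    using c by (intro tendsto_mult_left_zero LIMSEQ_realpow_zero) auto
  ultimately show ?thesis
    by (rule Lim_null_comparison)
qed

section \<open>Krawtchouk matrices\<close>

hide_const (open) Module.smult

text \<open>Substitution of \<open>(u, v)\<close> into the homogenisation of \<open>f\<close> as a binary form of degree \<open>n\<close>.\<close>

definition hom_subst :: "nat \<Rightarrow> 'a::comm_ring_1 poly \<Rightarrow> 'a poly \<Rightarrow> 'a poly \<Rightarrow> 'a poly" where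
  "hom_subst n u v f = (\<Sum>j\<le>n. smult (coeff f j) (u ^ j * v ^ (n - j)))"

lemma hom_subst_0 [simp]: "hom_subst 0 u v f = [:coeff f 0:]"
  by (simp add: hom_subst_def one_pCons)

lemma hom_subst_add: "hom_subst n u v (f + g) = hom_subst n u v f + hom_subst n u v g"
  by (simp add: hom_subst_def smult_add_left sum.distrib)

lemma hom_subst_smult: "hom_subst n u v (smult c f) = smult c (hom_subst n u v f)"
proof -
  have "smult c (\<Sum>j\<le>n. h j) = (\<Sum>j\<le>n. smult c (h j))" for h :: "nat \<Rightarrow> 'a poly"
    by (induction n) (simp_all add: smult_add_right)
  then show ?thesis by (simp add: hom_subst_def)
qed

lemma hom_subst_pCons:
  "hom_subst (Suc n) u v (pCons c f) = smult c (v ^ Suc n) + u * hom_subst n u v f"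
  by (simp add: hom_subst_def sum.atMost_Suc_shift sum_distrib_left mult_ac del: sum.atMost_Suc)

lemma hom_subst_raise:
  assumes "degree f \<le> n"
  shows "hom_subst (n + k) u v f = v ^ k * hom_subst n u v f"
proof -
  have "hom_subst (n + k) u v f = (\<Sum>j\<le>n. smult (coeff f j) (u ^ j * v ^ (n + k - j)))"
    unfolding hom_subst_def using assms
    by (intro sum.mono_neutral_right) (auto simp: coeff_eq_0)
  also have "\<dots> = v ^ k * hom_subst n u v f"
    unfolding hom_subst_def sum_distrib_left
    by (intro sum.cong refl) (auto simp: power_add [symmetric] mult_ac add_ac)
  finally show ?thesis .
qed

text \<open>The degree bounds ensure that truncation at \<open>n\<close> and \<open>k\<close> loses
  no coefficient. The induction peels off the constant coefficient of \<open>f\<close>;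
  \<open>hom_subst_raise\<close> supplies the missing powers of \<open>v\<close>.\<close>

lemma hom_subst_mult:
  fixes u v :: "'a::idom poly"
  assumes "degree f \<le> n" "degree g \<le> k"
  shows "hom_subst (n + k) u v (f * g) = hom_subst n u v f * hom_subst k u v g"
  using assms(1)
proof (induction n arbitrary: f)
  case 0
  then obtain c where "f = [:c:]" by (metis degree_eq_zeroE le_zero_eq)
  then show ?case by (simp add: hom_subst_smult)
next
  case (Suc n)
  obtain c h where f: "f = pCons c h" by (cases f)
  have h: "degree h \<le> n" using Suc.prems f by (auto split: if_splits)
  have "hom_subst (Suc n + k) u v (f * g)
        = smult c (hom_subst (k + Suc n) u v g) + hom_subst (Suc (n + k)) u v (pCons 0 (h * g))"
    by (simp add: f hom_subst_add hom_subst_smult add_ac)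
  also have "\<dots> = hom_subst (Suc n) u v f * hom_subst k u v g"
    unfolding hom_subst_raise[OF assms(2)] hom_subst_pCons f using Suc.IH[OF h]
    by (simp add: algebra_simps)
  finally show ?case .
qed

lemma hom_subst_linear_power:
  fixes u v :: "'a::idom poly"
  shows "hom_subst n u v ([:b, a:] ^ n) = (smult a u + smult b v) ^ n"
proof (induction n)
  case (Suc n)
  have "hom_subst (1 + n) u v ([:b, a:] * [:b, a:] ^ n)
        = hom_subst 1 u v [:b, a:] * hom_subst n u v ([:b, a:] ^ n)"
    by (rule hom_subst_mult) (auto intro: order.trans[OF degree_power_le])
  moreover have "hom_subst 1 u v [:b, a:] = smult a u + smult b v"
    by (simp add: hom_subst_def add_ac)
  ultimately show ?case
    unfolding Suc power_Suc by simp
qed (simp add: one_pCons)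

section \<open>Krawtchouk polynomials and their weighted orthogonality\<close>

text \<open>Row \<open>j\<close> of the Krawtchouk matrix: the image of \<open>s ^ j\<close>, seen
  as a form of degree \<open>n\<close>, under the Hadamard substitution of \<open>s + 1\<close> and
  \<open>s - 1\<close> for the two variables.\<close>

definition krawtchouk :: "nat \<Rightarrow> nat \<Rightarrow> complex poly" where
  "krawtchouk n j = [:1, 1:] ^ j * [:-1, 1:] ^ (n - j)"

lemma degree_krawtchouk: "j \<le> n \<Longrightarrow> degree (krawtchouk n j) \<le> n"
  unfolding krawtchouk_def
  by (rule order.trans[OF degree_mult_le]) (simp add: degree_linear_power)

lemma coeff_linear_power_binomial:
  assumes "j \<le> n" shows "coeff ([:b, a:] ^ n) j = of_nat (n choose j) * a ^ j * (b::'a::comm_ring_1) ^ (n - j)"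
proof -
  have "[:b, a:] = monom a 1 + [:b:]" by (simp add: monom_altdef)
  have "[:b, a:] ^ n = (\<Sum>k\<le>n. of_nat (n choose k) * monom a 1 ^ k * [:b:] ^ (n - k))"
    unfolding \<open>[:b, a:] = _\<close> by (rule binomial_ring)
  also have "\<dots> = (\<Sum>k\<le>n. monom (of_nat (n choose k) * a ^ k * b ^ (n - k)) k)"
    by (intro sum.cong refl) (simp add: monom_power poly_const_pow smult_monom of_nat_poly mult_ac)
  finally show ?thesis using assms by (simp add: coeff_sum)
qed

text \<open>Two Hadamard substitutions send the variables to \<open>(s + 1) + (s - 1) = 2 s\<close>
  and \<open>(s + 1) - (s - 1) = 2\<close>, so \<open>s ^ j\<close> becomes
  \<open>2 ^ n s ^ j\<close>.\<close>

lemma krawtchouk_involution: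
  assumes "j \<le> n" "l \<le> n"
  shows "(\<Sum>i\<le>n. coeff (krawtchouk n j) i * coeff (krawtchouk n i) l) = (if l = j then 2 ^ n else 0)"
proof -
  have "hom_subst (j + (n - j)) [:1, 1:] [:-1, 1:] (krawtchouk n j)
        = [:0, 2:] ^ j * [:2:] ^ (n - j)"
    unfolding krawtchouk_def
    by (subst hom_subst_mult) (simp_all add: hom_subst_linear_power degree_linear_power)
  also have "\<dots> = monom (2 ^ n) j"
  proof -
    have "[:0, 2:] = monom (2::complex) 1" "[:2:] = monom (2::complex) 0"
      by (simp_all add: monom_altdef)
    then show ?thesis
      using assms by (simp add: monom_power mult_monom flip: power_add)
  qed
  finally have "coeff (hom_subst n [:1, 1:] [:-1, 1:] (krawtchouk n j)) l = (if l = j then 2 ^ n else 0)"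
    using assms by simp
  then show ?thesis
    by (simp add: hom_subst_def coeff_sum krawtchouk_def)
qed

text \<open>Both sides are coefficients of \<open>((s - 1) + (s + 1) t) ^ n\<close>, whose base
  \<open>s t + s + t - 1\<close> is symmetric in \<open>s\<close> and \<open>t\<close>.\<close>

lemma krawtchouk_symmetry:
  assumes "j \<le> n" "l \<le> n"
  shows "of_nat (n choose j) * coeff (krawtchouk n j) l = of_nat (n choose l) * coeff (krawtchouk n l) j"
proof -
  define F where "F m = [:[:-1, 1:], [:1, 1::complex:]:] ^ m" for m
  have sym: "coeff (coeff (F m) a) b = coeff (coeff (F m) b) a" for m a b
  proof (induction m arbitrary: a b)
    case 0
    then show ?case by (auto simp: F_def one_pCons coeff_pCons split: nat.splits)
  next
    case (Suc m)
    have F: "F (Suc m) = smult [:-1, 1:] (F m) + pCons 0 (smult [:1, 1:] (F m))"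
      by (simp add: F_def)
    show ?case
      unfolding F by (cases a; cases b) (simp_all add: Suc.IH[of a] Suc.IH)
  qed
  have "coeff (coeff (F n) a) b = of_nat (n choose a) * coeff (krawtchouk n a) b" if "a \<le> n" for a b
    unfolding F_def coeff_linear_power_binomial[OF that] krawtchouk_def
    by (simp add: of_nat_poly mult.assoc)
  then show ?thesis using sym assms by metis
qed

lemma krawtchouk_orthogonal:
  assumes "i \<le> n" "j \<le> n"
  shows "(\<Sum>l\<le>n. coeff (krawtchouk n i) l * coeff (krawtchouk n j) l / of_nat (n choose l))
         = (if i = j then 2 ^ n / of_nat (n choose j) else 0)"
proof -
  have "coeff (krawtchouk n j) l / of_nat (n choose l) = coeff (krawtchouk n l) j / of_nat (n choose j)"
    if "l \<le> n" for l
    using krawtchouk_symmetry[OF assms(2) that] that assms by (simp add: field_simps)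
  then have "(\<Sum>l\<le>n. coeff (krawtchouk n i) l * coeff (krawtchouk n j) l / of_nat (n choose l))
     = (\<Sum>l\<le>n. coeff (krawtchouk n i) l * coeff (krawtchouk n l) j) / of_nat (n choose j)"
    unfolding sum_divide_distrib
    by (intro sum.cong refl) (metis atMost_iff times_divide_eq_right)
  then show ?thesis
    using krawtchouk_involution[OF assms] by auto
qed

lemma coeff_krawtchouk_real: "coeff (krawtchouk n j) l \<in> \<real>"
proof -
  have mult: "coeff (p * q) l \<in> \<real>" if "\<And>l. coeff p l \<in> \<real>" "\<And>l. coeff q l \<in> \<real>"
    for p q :: "complex poly" and l
    using that by (simp add: coeff_mult)
  have pow: "coeff (p ^ k) l \<in> \<real>" if "\<And>l. coeff p l \<in> \<real>" for p :: "complex poly" and k l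
    using that by (induction k arbitrary: l) (auto intro: mult)
  have lin: "coeff [:b, 1:] l \<in> \<real>" if "b \<in> \<real>" for b :: complex and l
    using that by (auto simp: coeff_pCons split: nat.splits)
  show ?thesis
    unfolding krawtchouk_def by (intro mult pow lin) auto
qed

text \<open>After expanding the square and summing over \<open>l\<close> first, orthogonality leaves
  only diagonal terms. In this weighted norm the Krawtchouk matrix is a multiple of an
  isometry.\<close>

lemma krawtchouk_parseval:
  "(\<Sum>l\<le>n. (cmod (\<Sum>j\<le>n. coeff (krawtchouk n j) l * b j))\<^sup>2 / real (n choose l))
   = 2 ^ n * (\<Sum>j\<le>n. (cmod (b j))\<^sup>2 / real (n choose j))"
proof -
  let ?K = "\<lambda>j l. coeff (krawtchouk n j) l"
  have cnj: "cnj (?K j l) = ?K j l" for j l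
    using coeff_krawtchouk_real by (simp add: Reals_cnj_iff)
  have sq: "complex_of_real ((cmod z)\<^sup>2 / real c) = z * cnj z / of_nat c" for z c
    by (simp only: of_real_divide complex_norm_square of_real_of_nat_eq)
  have "complex_of_real (\<Sum>l\<le>n. (cmod (\<Sum>j\<le>n. ?K j l * b j))\<^sup>2 / real (n choose l))
        = (\<Sum>l\<le>n. \<Sum>i\<le>n. \<Sum>j\<le>n. b i * cnj (b j) * (?K i l * ?K j l / of_nat (n choose l)))"
    unfolding of_real_sum sq
    by (simp add: cnj sum_product sum_divide_distrib mult_ac)
  also have "\<dots> = (\<Sum>i\<le>n. \<Sum>j\<le>n. b i * cnj (b j) * (\<Sum>l\<le>n. ?K i l * ?K j l / of_nat (n choose l)))"
    unfolding sum_distrib_left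
    by (subst sum.swap, rule sum.cong[OF refl], rule sum.swap)
  also have "\<dots> = (\<Sum>i\<le>n. \<Sum>j\<le>n. if i = j then b i * cnj (b j) * (2 ^ n / of_nat (n choose j)) else 0)"
    by (intro sum.cong refl) (auto simp: krawtchouk_orthogonal)
  also have "\<dots> = (\<Sum>i\<le>n. b i * cnj (b i) * (2 ^ n / of_nat (n choose i)))"
    by (intro sum.cong refl) simp
  also have "\<dots> = complex_of_real (2 ^ n * (\<Sum>j\<le>n. (cmod (b j))\<^sup>2 / real (n choose j)))"
    unfolding of_real_mult of_real_sum sq
    by (simp add: sum_distrib_left mult_ac)
  finally show ?thesis
    by (simp only: of_real_eq_iff)
qed

section \<open>Exclusion of eigenvalues of modulus at least 1\<close>

lemma krawtchouk_system_eigenvector_eq_0: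
  fixes x :: "nat \<times> nat \<Rightarrow> complex"
  assumes m: "m \<ge> 1" and n: "n = 2 * m" and tau: "cmod \<tau> = 1 / 2 ^ m" and lam: "1 \<le> cmod \<mu>"
    and eig: "\<And>h l. h \<le> n \<Longrightarrow> l \<le> n \<Longrightarrow> \<mu> * x (h, l) =
       (\<Sum>(g, j)\<in>{..n} \<times> {..n}.
          (if g + j = 2 * h then \<tau> * coeff (krawtchouk n j) l else 0) * x (g, j))"
    and hl: "h \<le> n" "l \<le> n"
  shows "x (h, l) = 0"
proof -
  let ?K = "\<lambda>j l. coeff (krawtchouk n j) l"
  \<comment> \<open>\<open>b h j\<close> is \<open>x (2h - j, j)\<close>, read as 0 when
    \<open>2h - j\<close> lies outside \<open>0..n\<close>.\<close>
  define b where "b h j = (\<Sum>g\<le>n. if g + j = 2 * h then x (g, j) else 0)" for h j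
  have b1: "b h j = x (g, j)" if "g + j = 2 * h" "g \<le> n" for g h j
  proof -
    have "(g' + j = 2 * h) = (g' = g)" for g' using that by auto
    then show ?thesis using that by (simp add: b_def)
  qed
  have b0: "b h j = 0" if "\<And>g. g + j = 2 * h \<Longrightarrow> g \<le> n \<Longrightarrow> x (g, j) = 0" for h j
    using that by (auto simp: b_def intro!: sum.neutral)
  have "\<mu> \<noteq> 0" "\<tau> \<noteq> 0" using lam tau by auto
  have eig': "\<mu> * x (h, l) = \<tau> * (\<Sum>j\<le>n. ?K j l * b h j)" if "h \<le> n" "l \<le> n" for h l
  proof -
    have "\<mu> * x (h, l) = (\<Sum>g\<le>n. \<Sum>j\<le>n. \<tau> * (?K j l * (if g + j = 2 * h then x (g, j) else 0)))"
      unfolding eig[OF that] sum.cartesian_product [symmetric]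
      by (intro sum.cong refl) auto
    also have "\<dots> = \<tau> * (\<Sum>j\<le>n. ?K j l * b h j)"
      unfolding b_def sum_distrib_left by (rule sum.swap)
    finally show ?thesis .
  qed
  \<comment> \<open>\<open>krawtchouk_involution\<close> inverts the recurrence step: row
    \<open>h\<close> of \<open>x\<close> determines every \<open>b h j\<close>, so a vanishing row
    forces \<open>b h j = 0\<close>.\<close>
  have inv: "2 ^ n * \<tau> * b h j = \<mu> * (\<Sum>l\<le>n. x (h, l) * ?K l j)" if "h \<le> n" "j \<le> n" for h j
  proof -
    have "\<mu> * (\<Sum>l\<le>n. x (h, l) * ?K l j) = (\<Sum>l\<le>n. (\<mu> * x (h, l)) * ?K l j)"
      by (simp add: sum_distrib_left mult_ac)
    also have "\<dots> = (\<Sum>l\<le>n. \<Sum>i\<le>n. \<tau> * b h i * (?K i l * ?K l j))"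
      by (intro sum.cong refl) (simp add: eig' that sum_distrib_left sum_distrib_right mult_ac)
    also have "\<dots> = (\<Sum>i\<le>n. \<tau> * b h i * (\<Sum>l\<le>n. ?K i l * ?K l j))"
      unfolding sum_distrib_left by (rule sum.swap)
    also have "\<dots> = (\<Sum>i\<le>n. if i = j then 2 ^ n * \<tau> * b h i else 0)"
      by (intro sum.cong refl) (use that in \<open>auto simp: krawtchouk_involution\<close>)
    finally show ?thesis using that by simp
  qed
  define w where "w g j = (cmod (x (g, j)))\<^sup>2 / real (n choose j)" for g j
  have w_nonneg: "w g j \<ge> 0" for g j by (simp add: w_def)
  \<comment> \<open>For fixed \<open>j\<close>, an index \<open>g\<close> with \<open>g + j\<close>
    even is hit by exactly one \<open>h\<close>, and one with \<open>g + j\<close> odd by none. So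
    \<open>b\<close> loses precisely the odd part of the weighted norm of \<open>x\<close>, which
    must therefore vanish when \<open>\<mu>\<close> has modulus at least 1.\<close>
  have norm_b: "(\<Sum>h\<le>n. (cmod (b h j))\<^sup>2 / real (n choose j)) = (\<Sum>g\<le>n. if even (g + j) then w g j else 0)"
    if "j \<le> n" for j
  proof -
    have "(cmod (b h j))\<^sup>2 / real (n choose j) = (\<Sum>g\<le>n. if g + j = 2 * h then w g j else 0)" for h
    proof (cases "\<exists>g\<le>n. g + j = 2 * h")
      case True
      then obtain g where g: "g \<le> n" "g + j = 2 * h" by blast
      have "(g' + j = 2 * h) = (g' = g)" for g' using g by auto
      then show ?thesis using g b1[OF g(2,1)] by (simp add: w_def)
    next
      case False
      then have "b h j = 0" by (intro b0) auto
      with False show ?thesis by (auto intro!: sum.neutral [symmetric])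
    qed
    then have "(\<Sum>h\<le>n. (cmod (b h j))\<^sup>2 / real (n choose j))
               = (\<Sum>h\<le>n. \<Sum>g\<le>n. if g + j = 2 * h then w g j else 0)"
      by (simp only:)
    also have "\<dots> = (\<Sum>g\<le>n. \<Sum>h\<le>n. if g + j = 2 * h then w g j else 0)"
      by (rule sum.swap)
    also have "\<dots> = (\<Sum>g\<le>n. if even (g + j) then w g j else 0)"
    proof (intro sum.cong refl)
      fix g assume "g \<in> {..n}"
      then have "(g + j) div 2 \<le> n" using \<open>j \<le> n\<close> by simp
      show "(\<Sum>h\<le>n. if g + j = 2 * h then w g j else 0) = (if even (g + j) then w g j else 0)"
      proof (cases "even (g + j)")
        case True
        then have "(g + j = 2 * h) = (h = (g + j) div 2)" for h by auto
        with True \<open>(g + j) div 2 \<le> n\<close> show ?thesis by simp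
      next
        case False
        then have "g + j \<noteq> 2 * h" for h by (metis dvd_triv_left)
        with False show ?thesis by simp
      qed
    qed
    finally show ?thesis .
  qed
  have tau2: "(cmod \<tau>)\<^sup>2 * 2 ^ n = 1"
    by (simp add: tau n power_divide mult.commute flip: power_mult)
  define W where "W = (\<Sum>h\<le>n. \<Sum>l\<le>n. w h l)"
  have "(cmod \<mu>)\<^sup>2 * W = (\<Sum>h\<le>n. \<Sum>l\<le>n. (cmod (\<mu> * x (h, l)))\<^sup>2 / real (n choose l))"
    by (simp add: W_def w_def sum_distrib_left norm_mult power_mult_distrib)
  also have "\<dots> = (\<Sum>h\<le>n. (cmod \<tau>)\<^sup>2 * (\<Sum>l\<le>n. (cmod (\<Sum>j\<le>n. ?K j l * b h j))\<^sup>2 / real (n choose l)))"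
    unfolding sum_distrib_left [of "(cmod \<tau>)\<^sup>2"]
    by (intro sum.cong refl) (simp add: eig' norm_mult power_mult_distrib)
  also have "\<dots> = (\<Sum>h\<le>n. \<Sum>j\<le>n. (cmod (b h j))\<^sup>2 / real (n choose j))"
    unfolding krawtchouk_parseval mult.assoc [symmetric] tau2 by simp
  also have "\<dots> = (\<Sum>j\<le>n. \<Sum>g\<le>n. if even (g + j) then w g j else 0)"
    by (subst sum.swap) (simp add: norm_b)
  finally have 1: "(cmod \<mu>)\<^sup>2 * W = (\<Sum>j\<le>n. \<Sum>g\<le>n. if even (g + j) then w g j else 0)" .
  have "1 * W \<le> (cmod \<mu>)\<^sup>2 * W"
    using lam w_nonneg by (intro mult_right_mono) (auto simp: W_def sum_nonneg one_le_power)
  moreover have "W = (\<Sum>j\<le>n. \<Sum>g\<le>n. if even (g + j) then w g j else 0)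
                    + (\<Sum>j\<le>n. \<Sum>g\<le>n. if odd (g + j) then w g j else 0)"
    unfolding W_def sum.distrib [symmetric] by (subst sum.swap) (intro sum.cong refl, auto)
  ultimately have "(\<Sum>j\<le>n. \<Sum>g\<le>n. if odd (g + j) then w g j else 0) \<le> 0"
    using 1 by linarith
  moreover have "(\<Sum>j\<le>n. \<Sum>g\<le>n. if odd (g + j) then w g j else 0) \<ge> 0"
    using w_nonneg by (intro sum_nonneg) auto
  ultimately have W_odd: "(\<Sum>j\<le>n. \<Sum>g\<le>n. if odd (g + j) then w g j else 0) = 0"
    by linarith
  have w0: "(if odd (g + j) then w g j else 0) = 0" if "g \<le> n" "j \<le> n" for g j
  proof -
    have "(\<Sum>g\<le>n. if odd (g + j) then w g j else 0) = 0"
      using that w_nonneg by (intro sum_nonneg_0[OF _ _ W_odd]) (auto intro!: sum_nonneg)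
    from sum_nonneg_0[OF _ _ this, of g] that w_nonneg show ?thesis by auto
  qed
  have parity: "x (g, j) = 0" if "g \<le> n" "j \<le> n" "odd (g + j)" for g j
    using w0[OF that(1,2)] that by (auto simp: w_def)
  show ?thesis
  proof (rule ccontr)
    assume nz: "x (h, l) \<noteq> 0"
    define S where "S = {h. h \<le> n \<and> (\<exists>l\<le>n. x (h, l) \<noteq> 0)}"
    define D where "D = Max S"
    have S: "finite S" "S \<noteq> {}" using nz hl by (auto simp: S_def)
    have D: "D \<le> n" "\<exists>l\<le>n. x (D, l) \<noteq> 0" using Max_in[OF S] by (auto simp: D_def S_def)
    have top: "x (g, j) = 0" if "g > D" "g \<le> n" "j \<le> n" for g j
    proof (rule ccontr)
      assume "x (g, j) \<noteq> 0"
      then have "g \<in> S" using that by (auto simp: S_def)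
      then have "g \<le> D" using S by (simp add: D_def)
      with that show False by simp
    qed
    \<comment> \<open>For \<open>j > D\<close> of the parity of \<open>D\<close>, the midpoint
      \<open>g = (D + j) / 2\<close> exceeds \<open>D\<close>, so row \<open>g\<close> vanishes;
      then \<open>inv\<close> gives \<open>b g j = 0\<close>, and \<open>b g j\<close> is
      \<open>x (D, j)\<close>.\<close>
    have low: "x (D, j) = 0" if "j > D" "j \<le> n" for j
    proof (cases "even (D + j)")
      case True
      then obtain g where g: "D + j = 2 * g" by (elim evenE)
      have "2 ^ n * \<tau> * b g j = \<mu> * (\<Sum>l\<le>n. x (g, l) * ?K l j)"
        using g that by (intro inv) auto
      also have "\<dots> = 0" using g that by (auto intro!: sum.neutral top)
      finally have "b g j = 0" using \<open>\<tau> \<noteq> 0\<close> by simp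
      then show ?thesis using b1[OF g] D by simp
    qed (use parity that D in auto)
    \<comment> \<open>only \<open>j \<ge> D\<close> contribute to row \<open>D\<close>, and \<open>(s + 1)\<^sup>D\<close> divides each of their \<open>krawtchouk n j\<close>\<close>
    define A where "A = (\<Sum>l\<le>n. monom (x (D, l)) l)"
    have A: "coeff A l = (if l \<le> n then x (D, l) else 0)" for l
      by (simp add: A_def coeff_sum)
    have "smult \<mu> A = smult \<tau> (\<Sum>j\<le>n. smult (b D j) (krawtchouk n j))"
    proof (rule poly_eqI)
      fix l
      show "coeff (smult \<mu> A) l = coeff (smult \<tau> (\<Sum>j\<le>n. smult (b D j) (krawtchouk n j))) l"
      proof (cases "l \<le> n")
        case True
        then show ?thesis using eig'[OF D(1) True] by (simp add: A coeff_sum mult_ac)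
      next
        case False
        then have "coeff (krawtchouk n j) l = 0" if "j \<le> n" for j
          using degree_krawtchouk[OF that] by (intro coeff_eq_0) simp
        with False show ?thesis by (simp add: A coeff_sum)
      qed
    qed
    moreover have "[:1, 1:] ^ D dvd smult (b D j) (krawtchouk n j)" if "j \<le> n" for j
    proof (cases "j < D")
      case True
      then have "b D j = 0" using that by (intro b0 top) auto
      then show ?thesis by simp
    next
      case False
      then show ?thesis
        unfolding krawtchouk_def by (intro dvd_smult dvd_mult2 le_imp_power_dvd) simp
    qed
    ultimately have "[:1, 1:] ^ D dvd smult \<mu> A"
      by (simp only:) (rule dvd_smult, rule dvd_sum, simp)
    then have "[:1, 1:] ^ D dvd A" using \<open>\<mu> \<noteq> 0\<close> by (simp add: dvd_smult_iff)
    then obtain B where B: "A = [:1, 1:] ^ D * B" by (elim dvdE)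
    have "A \<noteq> 0" using D(2) A by (metis coeff_0)
    then have "B \<noteq> 0" using B by auto
    have "degree A \<le> D" using low by (intro degree_le) (auto simp: A)
    moreover have "degree A = D + degree B"
      unfolding B using \<open>B \<noteq> 0\<close> by (subst degree_mult_eq) (auto simp: degree_linear_power)
    ultimately obtain c where "B = [:c:]" by (metis add_le_same_cancel1 degree_eq_zeroE le_zero_eq)
    then have c: "c \<noteq> 0" "A = smult c ([:1, 1:] ^ D)" using B \<open>B \<noteq> 0\<close> by auto
    show False
    proof (cases D)
      \<comment> \<open>In row 0 only \<open>j = 0\<close> contributes, since \<open>0 - j\<close>
        is otherwise out of range. This leaves a scalar equation for \<open>x (0, 0)\<close> with a
        factor of modulus \<open>1 / 2 ^ m\<close>.\<close>
      case 0
      have x00: "x (0, 0) \<noteq> 0" using A[of 0] c 0 by simp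
      have "b 0 j = 0" if "j \<noteq> 0" for j using that by (intro b0) auto
      then have "(\<Sum>j\<le>n. ?K j 0 * b 0 j) = (\<Sum>j\<le>n. if j = 0 then ?K 0 0 * x (0, 0) else 0)"
        using b1[of 0 0 0] by (intro sum.cong refl) auto
      then have "\<mu> * x (0, 0) = \<tau> * ?K 0 0 * x (0, 0)"
        using eig'[of 0 0] by simp
      then have "\<mu> = \<tau> * ?K 0 0" using x00 by simp
      moreover have "cmod (?K 0 0) = 1"
        by (simp add: krawtchouk_def coeff_linear_power_binomial norm_power)
      ultimately have "cmod \<mu> = 1 / 2 ^ m" using tau by (simp add: norm_mult)
      also have "\<dots> < 1" using m by simp
      finally show False using lam by simp
    next
      case (Suc d)
      \<comment> \<open>At the coefficient of degree \<open>D - 1\<close>, parity gives 0, as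
        \<open>D + d\<close> is odd, while \<open>c (s + 1) ^ D\<close> gives
        \<open>c * D\<close>.\<close>
      have "x (D, d) = 0" using D Suc by (intro parity) auto
      then have "coeff A d = 0" by (simp add: A)
      moreover have "coeff A d = c * of_nat (Suc d)"
        unfolding c(2) Suc coeff_smult
        by (subst coeff_linear_power_binomial) (simp_all del: of_nat_Suc)
      ultimately show False using c(1) by (simp del: of_nat_Suc)
    qed
  qed
qed

section \<open>Rudin-Shapiro forms and their Fourier coefficients\<close>

text \<open>On the circle the rows \<open>(p, q)\<close> and \<open>(- cnj q, cnj p)\<close> form a
  matrix in SU(2), so this is the image of the monomial with both exponents \<open>m\<close> in the
  representation on binary forms of degree \<open>2 * m\<close>.\<close>

definition rs_form :: "nat \<Rightarrow> nat \<Rightarrow> complex \<Rightarrow> complex poly" where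
  "rs_form m k z = (let p = poly (RS_P k) z / sqrt (2 ^ (k + 1)); q = poly (RS_Q k) z / sqrt (2 ^ (k + 1))
     in [:q, p:] ^ m * [:cnj p, - cnj q:] ^ m)"

lemma RS_Suc:
  "poly (RS_P (Suc k)) z = poly (RS_P k) z + z ^ 2 ^ k * poly (RS_Q k) z"
  "poly (RS_Q (Suc k)) z = poly (RS_P k) z - z ^ 2 ^ k * poly (RS_Q k) z"
  by (simp_all add: RS_P_def RS_Q_def case_prod_beta Let_def poly_monom)

lemma RS_0: "RS_P 0 = 1" "RS_Q 0 = 1"
  by (simp_all add: RS_P_def RS_Q_def)

lemma RS_norm_sum:
  assumes "cmod z = 1"
  shows "(cmod (poly (RS_P k) z))\<^sup>2 + (cmod (poly (RS_Q k) z))\<^sup>2 = 2 ^ (k + 1)"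
proof (induction k)
  case (Suc k)
  have par: "(cmod (a + b))\<^sup>2 + (cmod (a - b))\<^sup>2 = 2 * ((cmod a)\<^sup>2 + (cmod b)\<^sup>2)" for a b
    unfolding cmod_power2 by (simp add: power2_eq_square algebra_simps)
  show ?case
    using Suc assms by (simp add: RS_Suc par norm_mult norm_power)
qed (simp add: RS_0)

text \<open>Replacing \<open>(p, q)\<close> by \<open>(p + w q, p - w q) / sqrt 2\<close> acts on
  the first linear factor, up to \<open>1 / sqrt 2\<close>, as the substitution of
  \<open>s + 1\<close> and \<open>w (s - 1)\<close> for the variables. On the second factor the same
  substitution must be corrected by \<open>- cnj w\<close>, because
  \<open>w * cnj w = 1\<close>.\<close>

lemma rs_form_Suc:
  fixes z :: complex and k m :: nat
  assumes z: "cmod z = 1"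
  defines "w \<equiv> z ^ 2 ^ k"
  shows "rs_form m (Suc k) z = smult ((- cnj w) ^ m / 2 ^ m)
           (\<Sum>j\<le>2 * m. smult (w ^ (2 * m - j) * coeff (rs_form m k z) j) (krawtchouk (2 * m) j))"
proof -
  define p where "p = poly (RS_P k) z / sqrt (2 ^ (k + 1))"
  define q where "q = poly (RS_Q k) z / sqrt (2 ^ (k + 1))"
  have "cmod w = 1" using z by (simp add: w_def norm_power)
  then have w: "w * cnj w = 1" by (simp add: complex_norm_square [symmetric])
  let ?u = "[:1, 1:] :: complex poly" and ?v = "smult w [:-1, 1:] :: complex poly"
  let ?r = "complex_of_real (sqrt 2)"
  have r: "?r * ?r = 2"
    by (subst of_real_mult [symmetric]) simp
  have pq': "poly (RS_P (Suc k)) z / sqrt (2 ^ (Suc k + 1)) = (p + w * q) / ?r"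
            "poly (RS_Q (Suc k)) z / sqrt (2 ^ (Suc k + 1)) = (p - w * q) / ?r"
    by (simp_all add: p_def q_def RS_Suc w_def real_sqrt_mult field_simps r)
  have form: "rs_form m k z = [:q, p:] ^ m * [:cnj p, - cnj q:] ^ m"
    by (simp add: rs_form_def p_def q_def)
  have "(\<Sum>j\<le>2 * m. smult (w ^ (2 * m - j) * coeff (rs_form m k z) j) (krawtchouk (2 * m) j))
        = hom_subst (m + m) ?u ?v (rs_form m k z)"
    unfolding hom_subst_def krawtchouk_def mult_2
    by (intro sum.cong refl) (simp add: smult_power mult_ac del: smult_pCons)
  also have "\<dots> = ([:p - w * q, p + w * q:] * [:- cnj q - w * cnj p, - cnj q + w * cnj p:]) ^ m"
    unfolding form power_mult_distrib
    by (subst hom_subst_mult)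
       (auto intro: order.trans[OF degree_power_le] simp: hom_subst_linear_power
             add.commute mult.commute)
  finally have "smult ((- cnj w) ^ m / 2 ^ m)
       (\<Sum>j\<le>2 * m. smult (w ^ (2 * m - j) * coeff (rs_form m k z) j) (krawtchouk (2 * m) j))
     = (smult (- cnj w / 2) ([:p - w * q, p + w * q:] * [:- cnj q - w * cnj p, - cnj q + w * cnj p:])) ^ m"
    by (simp only: smult_power power_divide)
  also have "smult (- cnj w / 2) ([:p - w * q, p + w * q:] * [:- cnj q - w * cnj p, - cnj q + w * cnj p:])
    = smult (1 / 2) ([:p - w * q, p + w * q:] * smult (- cnj w) [:- cnj q - w * cnj p, - cnj q + w * cnj p:])"
    by (simp only: mult_smult_right smult_smult) simp
  also have "smult (- cnj w) [:- cnj q - w * cnj p, - cnj q + w * cnj p:]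
    = [:cnj (p + w * q), - cnj (p - w * q):]"
    using w by (simp add: algebra_simps)
  also have "smult (1 / 2) ([:p - w * q, p + w * q:] * [:cnj (p + w * q), - cnj (p - w * q):])
    = smult (1 / ?r) [:p - w * q, p + w * q:] * smult (1 / ?r) [:cnj (p + w * q), - cnj (p - w * q):]"
    unfolding mult_smult_left mult_smult_right smult_smult by (simp add: r)
  finally show ?thesis
    unfolding rs_form_def Let_def pq'
    by (simp add: power_mult_distrib diff_divide_distrib add_divide_distrib del: mult_pCons_left mult_pCons_right)
qed

text \<open>The classical expansion of the Legendre polynomial in powers of \<open>x + 1\<close> and
  \<open>x - 1\<close>, taken at \<open>x = 2 t - 1\<close>.\<close>

definition shifted_legendre :: "nat \<Rightarrow> real poly" where
  "shifted_legendre m = (\<Sum>i\<le>m. smult ((real (m choose i))\<^sup>2) (monom 1 i * [:-1, 1:] ^ (m - i)))"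

text \<open>Convolving the two binomial expansions pairs each \<open>p\<close> with
  \<open>cnj p\<close> and each \<open>q\<close> with \<open>- cnj q\<close>, so only
  \<open>|p|^2 = t\<close> and \<open>- |q|^2 = t - 1\<close> remain.\<close>

lemma coeff_rs_form_middle:
  assumes "cmod z = 1"
  shows "coeff (rs_form m k z) m
         = of_real (poly (shifted_legendre m) ((cmod (poly (RS_P k) z) / sqrt (2 ^ (k + 1)))\<^sup>2))"
proof -
  define p where "p = poly (RS_P k) z / sqrt (2 ^ (k + 1))"
  define q where "q = poly (RS_Q k) z / sqrt (2 ^ (k + 1))"
  define t where "t = (cmod p)\<^sup>2"
  have "(cmod p)\<^sup>2 + (cmod q)\<^sup>2 = 1"
    using RS_norm_sum[OF assms, of k]
    by (simp add: p_def q_def norm_divide power_divide flip: add_divide_distrib)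
  then have pq: "p * cnj p = of_real t" "- (q * cnj q) = of_real (t - 1)"
    unfolding t_def complex_norm_square [symmetric] of_real_minus [symmetric] of_real_eq_iff
    by simp_all
  have "coeff (rs_form m k z) m = (\<Sum>i\<le>m. coeff ([:q, p:] ^ m) i * coeff ([:cnj p, - cnj q:] ^ m) (m - i))"
    by (simp add: rs_form_def coeff_mult p_def q_def)
  also have "\<dots> = (\<Sum>i\<le>m. of_nat (m choose i) * of_nat (m choose i) * (p * cnj p) ^ i * (- (q * cnj q)) ^ (m - i))"
  proof (intro sum.cong refl)
    fix i assume "i \<in> {..m}"
    then have i: "i \<le> m" by simp
    have "(- (q * cnj q)) ^ (m - i) = q ^ (m - i) * (- cnj q) ^ (m - i)"
      by (simp flip: power_mult_distrib)
    then show "coeff ([:q, p:] ^ m) i * coeff ([:cnj p, - cnj q:] ^ m) (m - i)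
      = of_nat (m choose i) * of_nat (m choose i) * (p * cnj p) ^ i * (- (q * cnj q)) ^ (m - i)"
      using i by (simp add: coeff_linear_power_binomial power_mult_distrib binomial_symmetric [symmetric] mult_ac)
  qed
  also have "\<dots> = of_real (poly (shifted_legendre m) t)"
    unfolding pq shifted_legendre_def
    by (simp add: poly_sum poly_monom power2_eq_square mult_ac)
  finally show ?thesis
    by (simp add: t_def p_def norm_divide)
qed

section \<open>Integration over the unit interval and continuity of the forms\<close>

abbreviation unit_interval_measure :: "real measure" where
  "unit_interval_measure \<equiv> uniform_measure lborel {0..<1}"

lemma prob_space_unit_interval: "prob_space unit_interval_measure"
  by (intro prob_space_uniform_measure) auto

lemma borel_measurable_unit_interval:
  fixes f :: "real \<Rightarrow> 'b::topological_space"
  assumes "continuous_on UNIV f"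
  shows "f \<in> borel_measurable unit_interval_measure"
  using borel_measurable_continuous_onI[OF assms] by simp

lemma integrable_unit_interval:
  fixes f :: "real \<Rightarrow> 'b::euclidean_space"
  assumes "continuous_on UNIV f"
  shows "integrable unit_interval_measure f"
proof -
  interpret prob_space unit_interval_measure by (rule prob_space_unit_interval)
  have "compact (f ` {0..1})"
    using assms by (intro compact_continuous_image) (auto intro: continuous_on_subset)
  then obtain B where B: "\<And>t. t \<in> {0..1} \<Longrightarrow> norm (f t) \<le> B"
    by (metis compact_imp_bounded bounded_iff imageI)
  have "AE t in unit_interval_measure. t \<in> {0..<1}"
    by (intro AE_uniform_measureI) auto
  then have "AE t in unit_interval_measure. norm (f t) \<le> B"
    by eventually_elim (auto intro: B)
  moreover have "f \<in> borel_measurable unit_interval_measure"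
    using assms by (rule borel_measurable_unit_interval)
  ultimately show ?thesis by (rule integrable_const_bound)
qed

lemma integral_unit_interval:
  fixes f :: "real \<Rightarrow> 'b::euclidean_space"
  assumes "continuous_on UNIV f"
  shows "(\<integral>t. f t \<partial>unit_interval_measure) = integral {0..1} f"
proof -
  have [measurable]: "f \<in> borel_measurable borel"
    using borel_measurable_continuous_onI[OF assms] .
  have "unit_interval_measure = density lborel (\<lambda>t. ennreal (indicator {0..<1} t))"
    unfolding uniform_measure_def by (intro density_cong) (auto simp: indicator_def divide_ennreal_def)
  then have "(\<integral>t. f t \<partial>unit_interval_measure) = (\<integral>t. indicator {0..<1} t *\<^sub>R f t \<partial>lborel)"
    by (simp add: integral_density)
  also have "\<dots> = (\<integral>t. indicator {0..1} t *\<^sub>R f t \<partial>lborel)"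
  proof (rule integral_cong_AE)
    show "AE t in lborel. indicator {0..<1} t *\<^sub>R f t = indicator {0..1} t *\<^sub>R f t"
      using AE_lborel_singleton[of 1] by eventually_elim (auto simp: indicator_def)
  qed auto
  also have "\<dots> = set_lebesgue_integral lborel {0..1} f"
    by (simp add: set_lebesgue_integral_def)
  also have "\<dots> = integral {0..1} f"
    by (intro set_borel_integral_eq_integral borel_integrable_atLeastAtMost')
       (auto intro: continuous_on_subset[OF assms])
  finally show ?thesis .
qed

lemma integral_cis_eq_0:
  assumes "e \<noteq> 0"
  shows "(\<integral>t. cis (2 * pi * of_int e * t) \<partial>unit_interval_measure) = 0"
proof -
  let ?c = "2 * pi * of_int e :: real"
  have c: "?c \<noteq> 0" using assms by simp
  have "((\<lambda>t. cis (?c * t)) has_integral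
          cis (?c * 1) / (\<i> * of_real ?c) - cis (?c * 0) / (\<i> * of_real ?c)) {0..1}"
  proof (rule fundamental_theorem_of_calculus)
    fix t :: real
    have "((\<lambda>t. cis (?c * t) / (\<i> * of_real ?c)) has_vector_derivative
            (?c *\<^sub>R (\<i> * cis (?c * t))) / (\<i> * of_real ?c)) (at t within {0..1})"
      unfolding cis_conv_exp
      by (auto intro!: derivative_eq_intros has_vector_derivative_real_field simp: scaleR_conv_of_real)
    then show "((\<lambda>t. cis (?c * t) / (\<i> * of_real ?c)) has_vector_derivative cis (?c * t)) (at t within {0..1})"
      using c by (simp add: scaleR_conv_of_real mult_ac)
  qed simp
  moreover have "cis (?c * 1) = 1"
    by (simp add: cis_multiple_2pi)
  ultimately have "integral {0..1} (\<lambda>t. cis (?c * t)) = 0"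
    by (simp add: integral_unique)
  then show ?thesis
    by (subst integral_unit_interval) (auto intro!: continuous_intros)
qed

lemma continuous_on_coeff_mult:
  fixes p q :: "'a::topological_space \<Rightarrow> 'b::{comm_semiring_0, topological_semigroup_mult, topological_comm_monoid_add} poly"
  assumes "\<And>l. continuous_on S (\<lambda>t. coeff (p t) l)" "\<And>l. continuous_on S (\<lambda>t. coeff (q t) l)"
  shows "continuous_on S (\<lambda>t. coeff (p t * q t) l)"
  unfolding coeff_mult by (intro continuous_on_sum continuous_on_mult' assms)

lemma continuous_on_coeff_power:
  fixes p :: "'a::topological_space \<Rightarrow> 'b::{comm_semiring_1, topological_semigroup_mult, topological_comm_monoid_add} poly"
  assumes "\<And>l. continuous_on S (\<lambda>t. coeff (p t) l)"
  shows "continuous_on S (\<lambda>t. coeff (p t ^ n) l)"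
  by (induction n arbitrary: l) (auto intro: continuous_on_coeff_mult assms)

lemma continuous_on_coeff_linear:
  assumes "continuous_on S a" "continuous_on S b"
  shows "continuous_on S (\<lambda>t. coeff [:a t, b t:] l)"
proof (cases l)
  case (Suc l')
  with assms show ?thesis by (cases l') auto
qed (use assms in auto)

lemma continuous_on_coeff_rs_form:
  "continuous_on UNIV (\<lambda>t. coeff (rs_form m k (cis (2 * pi * t))) l)"
  unfolding rs_form_def Let_def
  by (intro continuous_on_coeff_mult continuous_on_coeff_power continuous_on_coeff_linear continuous_intros) auto

section \<open>Fourier coefficients of the forms and their recurrence\<close>

text \<open>The frequency is centred, so that \<open>h = m\<close> gives the mean; \<open>h\<close>
  is an integer because the recurrence reads the index \<open>2 * h - j\<close>, which may be
  negative.\<close>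

definition rs_fourier :: "nat \<Rightarrow> nat \<Rightarrow> int \<Rightarrow> nat \<Rightarrow> complex" where
  "rs_fourier m k h l = (\<integral>t. cis (2 * pi * of_int (2 ^ k * (h - int m)) * t)
      * coeff (rs_form m k (cis (2 * pi * t))) l \<partial>unit_interval_measure)"

text \<open>With \<open>w = z ^ 2 ^ k\<close>, the character at level \<open>k + 1\<close> is
  \<open>w ^ (2 h - 2 m)\<close>, and \<open>rs_form_Suc\<close> contributes
  \<open>w ^ (- m)\<close> and \<open>w ^ (2 m - j)\<close>. The total exponent
  \<open>(2 h - j) - m\<close> has the required shape at level \<open>k\<close>, so these
  frequencies form a closed system.\<close>

lemma rs_fourier_Suc:
  "rs_fourier m (Suc k) h l = (\<Sum>j\<le>2 * m. ((-1) ^ m / 2 ^ m) * coeff (krawtchouk (2 * m) j) l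
     * rs_fourier m k (2 * h - int j) j)"
proof -
  let ?e = "\<lambda>h t. cis (2 * pi * of_int (2 ^ k * (h - int m)) * t)"
  let ?c = "\<lambda>t. coeff (rs_form m k (cis (2 * pi * t)))"
  have phase: "cis (2 * pi * of_int (2 ^ Suc k * (h - int m)) * t) * (- cnj (cis (2 * pi * t) ^ 2 ^ k)) ^ m
                 * (cis (2 * pi * t) ^ 2 ^ k) ^ (2 * m - j)
             = (-1) ^ m * ?e (2 * h - int j) t" if "j \<le> 2 * m" for j t
  proof -
    define \<alpha> where "\<alpha> = 2 * pi * of_int (2 ^ Suc k * (h - int m)) * t"
    define \<beta> where "\<beta> = - (real m * (2 ^ k * (2 * pi * t)))"
    define \<gamma> where "\<gamma> = real (2 * m - j) * (2 ^ k * (2 * pi * t))"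
    have "(- cnj (cis (2 * pi * t) ^ 2 ^ k)) ^ m = (-1) ^ m * cis \<beta>"
      unfolding \<beta>_def by (subst power_minus) (simp add: Complex.DeMoivre cis_cnj flip: power_mult)
    moreover have "(cis (2 * pi * t) ^ 2 ^ k) ^ (2 * m - j) = cis \<gamma>"
      by (simp add: Complex.DeMoivre \<gamma>_def)
    ultimately have "cis \<alpha> * (- cnj (cis (2 * pi * t) ^ 2 ^ k)) ^ m * (cis (2 * pi * t) ^ 2 ^ k) ^ (2 * m - j)
        = (-1) ^ m * (cis \<alpha> * cis \<beta> * cis \<gamma>)"
      by (simp only: mult_ac)
    also have "cis \<alpha> * cis \<beta> * cis \<gamma> = cis (\<alpha> + \<beta> + \<gamma>)"
      by (simp only: cis_mult)
    also have "\<alpha> + \<beta> + \<gamma> = 2 * pi * of_int (2 ^ k * (2 * h - int j - int m)) * t"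
      using that by (simp add: \<alpha>_def \<beta>_def \<gamma>_def of_nat_diff algebra_simps)
    finally show ?thesis by (simp only: \<alpha>_def)
  qed
  have "cis (2 * pi * of_int (2 ^ Suc k * (h - int m)) * t) * coeff (rs_form m (Suc k) (cis (2 * pi * t))) l
       = (\<Sum>j\<le>2 * m. ((-1) ^ m / 2 ^ m) * coeff (krawtchouk (2 * m) j) l * (?e (2 * h - int j) t * ?c t j))" for t
    unfolding rs_form_Suc[of "cis (2 * pi * t)", OF norm_cis] coeff_smult coeff_sum sum_distrib_left
  proof (intro sum.cong refl)
    fix j assume "j \<in> {..2 * m}"
    then have "j \<le> 2 * m" by simp
    have regroup: "e * (b / c * (d * f * y)) = (e * b * d) / c * (f * y)" for e b c d f y :: complex
      by (simp add: mult_ac)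
    show "cis (2 * pi * of_int (2 ^ Suc k * (h - int m)) * t)
        * ((- cnj (cis (2 * pi * t) ^ 2 ^ k)) ^ m / 2 ^ m
           * ((cis (2 * pi * t) ^ 2 ^ k) ^ (2 * m - j) * ?c t j * coeff (krawtchouk (2 * m) j) l))
      = ((-1) ^ m / 2 ^ m) * coeff (krawtchouk (2 * m) j) l * (?e (2 * h - int j) t * ?c t j)"
      unfolding regroup phase[OF \<open>j \<le> 2 * m\<close>] by (simp add: mult_ac)
  qed
  then show ?thesis
    unfolding rs_fourier_def
    by (simp add: Bochner_Integration.integral_sum integrable_unit_interval
          continuous_on_coeff_rs_form continuous_intros)
qed

lemma rs_fourier_0: "h \<noteq> int m \<Longrightarrow> rs_fourier m 0 h l = 0"
  using integral_cis_eq_0[of "h - int m"] by (simp add: rs_fourier_def rs_form_def RS_0)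

text \<open>As \<open>0 <= j <= 2 m\<close>, passing from \<open>h\<close> to \<open>2 h - j\<close>
  keeps negative indices negative and indices above \<open>2 m\<close> above \<open>2 m\<close>; at
  \<open>k = 0\<close> only \<open>h = m\<close> can contribute. This makes the system
  finite.\<close>

lemma rs_fourier_outside: "h < 0 \<or> h > 2 * int m \<Longrightarrow> rs_fourier m k h l = 0"
proof (induction k arbitrary: h l)
  case 0
  then show ?case by (intro rs_fourier_0) auto
next
  case (Suc k)
  then show ?case
    unfolding rs_fourier_Suc by (intro sum.neutral) auto
qed

lemma rs_fourier_tendsto_0:
  assumes "m \<ge> 1"
  shows "(\<lambda>k. rs_fourier m k (int m) m) \<longlonglongrightarrow> 0"
proof -
  define n where "n = 2 * m"
  define \<tau> :: complex where "\<tau> = (-1) ^ m / 2 ^ m"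
  define x where "x k i = rs_fourier m k (int (fst i)) (snd i)" for k and i :: "nat \<times> nat"
  define a where "a i i' = (if fst i' + snd i' = 2 * fst i then \<tau> * coeff (krawtchouk n (snd i')) (snd i) else 0)"
    for i i' :: "nat \<times> nat"
  \<comment> \<open>The indices \<open>2 h - j\<close> outside \<open>0..n\<close>, absent from the
    sum, carry coefficient 0 by \<open>rs_fourier_outside\<close>.\<close>
  have shift: "rs_fourier m k (2 * int h - int j) j = (\<Sum>g\<le>n. if g + j = 2 * h then x k (g, j) else 0)" for k h j
  proof (cases "\<exists>g\<le>n. g + j = 2 * h")
    case True
    then obtain g where g: "g \<le> n" "g + j = 2 * h" by blast
    then have "(g' + j = 2 * h) = (g' = g)" for g' by auto
    moreover have shifted: "2 * int h - int j = int g" using g by linarith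
    ultimately show ?thesis unfolding shifted using g by (simp add: x_def)
  next
    case False
    have "2 * int h - int j < 0 \<or> 2 * int h - int j > 2 * int m"
    proof (rule ccontr)
      assume "\<not> ?thesis"
      then have "nat (2 * int h - int j) \<le> n" "nat (2 * int h - int j) + j = 2 * h"
        by (auto simp: n_def)
      with False show False by blast
    qed
    then have "rs_fourier m k (2 * int h - int j) j = 0" by (rule rs_fourier_outside)
    with False show ?thesis by (auto intro!: sum.neutral [symmetric])
  qed
  have "(\<lambda>k. x k (m, m)) \<longlonglongrightarrow> 0"
  proof (rule linear_recurrence_tendsto_0[where I = "{..n} \<times> {..n}" and a = a])
    fix k i assume "i \<in> {..n} \<times> {..n}"
    obtain h l where i: "i = (h, l)" by (cases i)
    have "x (Suc k) i = (\<Sum>j\<le>n. \<tau> * coeff (krawtchouk n j) l * rs_fourier m k (2 * int h - int j) j)"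
      by (simp add: x_def i rs_fourier_Suc n_def \<tau>_def)
    also have "\<dots> = (\<Sum>j\<le>n. \<Sum>g\<le>n. a i (g, j) * x k (g, j))"
      unfolding shift sum_distrib_left by (intro sum.cong refl) (auto simp: a_def i)
    also have "\<dots> = (\<Sum>i'\<in>{..n} \<times> {..n}. a i i' * x k i')"
      by (subst sum.swap) (simp add: sum.cartesian_product)
    finally show "x (Suc k) i = (\<Sum>i'\<in>{..n} \<times> {..n}. a i i' * x k i')" .
  next
    fix y :: "nat \<times> nat \<Rightarrow> complex" and \<mu> i
    assume eig: "\<And>i. i \<in> {..n} \<times> {..n} \<Longrightarrow> \<mu> * y i = (\<Sum>i'\<in>{..n} \<times> {..n}. a i i' * y i')"
      and mu: "1 \<le> cmod \<mu>" and i: "i \<in> {..n} \<times> {..n}"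
    have "y (fst i, snd i) = 0"
    proof (rule krawtchouk_system_eigenvector_eq_0[OF assms n_def _ mu])
      show "cmod \<tau> = 1 / 2 ^ m" by (simp add: \<tau>_def norm_divide norm_power)
      fix h l assume "h \<le> n" "l \<le> n"
      then show "\<mu> * y (h, l) = (\<Sum>(g, j)\<in>{..n} \<times> {..n}.
          (if g + j = 2 * h then \<tau> * coeff (krawtchouk n j) l else 0) * y (g, j))"
        using eig[of "(h, l)"] by (simp add: a_def case_prod_unfold cong: if_cong)
    qed (use i in auto)
    then show "y i = 0" by simp
  qed (auto simp: n_def)
  then show ?thesis by (simp add: x_def)
qed

section \<open>From Legendre means to weak convergence\<close>

text \<open>A Beta integral: each integration by parts trades a factor \<open>t - 1\<close> for a
  factor \<open>t\<close>, and the binomial coefficient absorbs the quotient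
  \<open>(d + 1) / (n + 1)\<close>.\<close>

lemma binomial_times_integral:
  "real ((n + d) choose d) * integral {0..1} (\<lambda>t::real. t ^ n * (t - 1) ^ d) = (-1) ^ d / real (n + d + 1)"
proof (induction d arbitrary: n)
  case 0
  have "((\<lambda>t::real. t ^ n) has_integral (1 ^ Suc n / real (Suc n) - 0 ^ Suc n / real (Suc n))) {0..1}"
  proof (rule fundamental_theorem_of_calculus)
    fix t :: real
    have "((\<lambda>t. t ^ Suc n / real (Suc n)) has_real_derivative t ^ n) (at t within {0..1})"
      using DERIV_cdivide[OF DERIV_pow[of "Suc n" t "{0..1}"], of "real (Suc n)"]
      by (simp del: power_Suc of_nat_Suc)
    then show "((\<lambda>t. t ^ Suc n / real (Suc n)) has_vector_derivative t ^ n) (at t within {0..1})"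
      by (simp only: has_real_derivative_iff_has_vector_derivative)
  qed simp
  then show ?case by (simp add: integral_unique)
next
  case (Suc d)
  let ?J = "\<lambda>n d. integral {0..1} (\<lambda>t::real. t ^ n * (t - 1) ^ d)"
  have int: "(\<lambda>t::real. t ^ n * (t - 1) ^ d) integrable_on {0..1}" for n d
    by (intro integrable_continuous_interval continuous_intros)
  have pw: "real k * y ^ (k - Suc 0) * y = real k * y ^ k" for k and y :: real
    by (cases k) auto
  \<comment> \<open>The integrand is the derivative of
    \<open>t ^ (n + 1) * (t - 1) ^ (d + 1)\<close>, which vanishes at both ends.\<close>
  have "((\<lambda>t::real. real (n + 1) * (t ^ n * (t - 1) ^ (d + 1)) + real (d + 1) * (t ^ (n + 1) * (t - 1) ^ d)) has_integral
     (1 ^ (n + 1) * (1 - 1) ^ (d + 1) - 0 ^ (n + 1) * (0 - 1) ^ (d + 1))) {0..1}"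
    by (rule fundamental_theorem_of_calculus)
       (auto intro!: derivative_eq_intros simp: pw
             simp flip: has_real_derivative_iff_has_vector_derivative, simp add: algebra_simps)
  moreover have "((\<lambda>t::real. real (n + 1) * (t ^ n * (t - 1) ^ (d + 1)) + real (d + 1) * (t ^ (n + 1) * (t - 1) ^ d)) has_integral
     (real (n + 1) * ?J n (d + 1) + real (d + 1) * ?J (n + 1) d)) {0..1}"
    by (intro has_integral_add has_integral_mult_right integrable_integral int)
  ultimately have parts: "real (n + 1) * ?J n (d + 1) + real (d + 1) * ?J (n + 1) d = 0"
    by (simp add: has_integral_unique)
  have "(d + 1) * ((n + d + 1) choose (d + 1)) = (n + 1) * ((n + d + 1) choose d)"
    using binomial_absorption[of d "n + d + 1"] binomial_absorb_comp[of "n + d + 1" d] by simp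
  then have binom: "real (d + 1) * real ((n + d + 1) choose (d + 1)) = real (n + 1) * real ((n + d + 1) choose d)"
    by (metis of_nat_mult)
  have "real (n + 1) * (real ((n + d + 1) choose (d + 1)) * ?J n (d + 1))
     = real (n + 1) * - (real ((n + d + 1) choose d) * ?J (n + 1) d)"
  proof -
    have J: "real (n + 1) * ?J n (d + 1) = - (real (d + 1) * ?J (n + 1) d)"
      using parts by linarith
    have "real (n + 1) * (real ((n + d + 1) choose (d + 1)) * ?J n (d + 1))
        = - (real (d + 1) * real ((n + d + 1) choose (d + 1)) * ?J (n + 1) d)"
      by (subst mult.left_commute) (simp only: J mult_minus_right mult_ac)
    also have "\<dots> = real (n + 1) * - (real ((n + d + 1) choose d) * ?J (n + 1) d)"
      by (simp only: binom mult_minus_right mult.assoc)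
    finally show ?thesis .
  qed
  then have "real ((n + d + 1) choose (d + 1)) * ?J n (d + 1) = - (real ((n + d + 1) choose d) * ?J (n + 1) d)"
    by (rule mult_left_cancel[THEN iffD1, rotated]) simp
  also have "\<dots> = - ((-1) ^ d / real (n + 1 + d + 1))"
    using Suc.IH[of "n + 1"] by simp
  finally show ?case by (simp add: add_ac)
qed

text \<open>One of the two binomial factors cancels against the Beta integral, leaving a multiple of
  the alternating sum of the \<open>m choose i\<close>.\<close>

lemma integral_shifted_legendre:
  assumes "m \<ge> 1"
  shows "integral {0..1} (poly (shifted_legendre m)) = 0"
proof -
  have "poly (shifted_legendre m) = (\<lambda>t. \<Sum>i\<le>m. (real (m choose i))\<^sup>2 * (t ^ i * (t - 1) ^ (m - i)))"
    by (auto simp: shifted_legendre_def poly_sum poly_monom fun_eq_iff)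
  then have "integral {0..1} (poly (shifted_legendre m))
     = (\<Sum>i\<le>m. (real (m choose i))\<^sup>2 * integral {0..1} (\<lambda>t::real. t ^ i * (t - 1) ^ (m - i)))"
    by (simp add: Henstock_Kurzweil_Integration.integral_sum integrable_continuous_interval continuous_intros)
  also have "\<dots> = (\<Sum>i\<le>m. real (m choose i) * ((-1) ^ (m - i) / real (m + 1)))"
  proof (intro sum.cong refl)
    fix i assume "i \<in> {..m}"
    then have "real (m choose i) * integral {0..1} (\<lambda>t::real. t ^ i * (t - 1) ^ (m - i)) = (-1) ^ (m - i) / real (m + 1)"
      using binomial_times_integral[of i "m - i"] binomial_symmetric[of i m] by simp
    then show "(real (m choose i))\<^sup>2 * integral {0..1} (\<lambda>t::real. t ^ i * (t - 1) ^ (m - i))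
        = real (m choose i) * ((-1) ^ (m - i) / real (m + 1))"
      by (simp only: power2_eq_square mult.assoc)
  qed
  also have "\<dots> = (-1) ^ m / real (m + 1) * (\<Sum>i\<le>m. (-1) ^ i * real (m choose i))"
    unfolding sum_distrib_left
    by (intro sum.cong refl) (auto simp: power_diff_conv_inverse power_inverse)
  also have "\<dots> = 0" using choose_alternating_sum[of m, where 'a = real] assms by simp
  finally show ?thesis .
qed

lemma degree_shifted_legendre: "degree (shifted_legendre m) \<le> m"
  unfolding shifted_legendre_def
  by (intro degree_sum_le order.trans[OF degree_smult_le] order.trans[OF degree_mult_le])
     (auto simp: degree_monom_eq degree_linear_power)

text \<open>Makes the degree exactly \<open>m\<close>, so that the Legendre means determine the
  moments recursively.\<close>

lemma coeff_shifted_legendre_top: "coeff (shifted_legendre m) m > 0"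
proof -
  have "coeff (monom 1 i * [:-1, 1::real:] ^ (m - i)) m = 1" if "i \<le> m" for i
    using that by (simp add: coeff_monom_mult coeff_linear_power_binomial)
  then have "coeff (shifted_legendre m) m = (\<Sum>i\<le>m. (real (m choose i))\<^sup>2)"
    by (simp add: shifted_legendre_def coeff_sum)
  also have "\<dots> > 0" by (intro sum_pos) auto
  finally show ?thesis .
qed

section \<open>Convergence of measures on the unit interval\<close>

context
  fixes \<mu> :: "nat \<Rightarrow> real measure"
  assumes distr: "\<And>k. real_distribution (\<mu> k)"
    and supp: "\<And>k. AE x in \<mu> k. x \<in> {0..1}"
begin

lemma integrable_unit_supported:
  fixes f :: "real \<Rightarrow> real"
  assumes "continuous_on UNIV f"
  shows "integrable (\<mu> k) f"
proof -
  interpret real_distribution "\<mu> k" by (rule distr)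
  have "compact (f ` {0..1})"
    using assms by (intro compact_continuous_image) (auto intro: continuous_on_subset)
  then obtain B where B: "\<And>t. t \<in> {0..1} \<Longrightarrow> norm (f t) \<le> B"
    by (metis compact_imp_bounded bounded_iff imageI)
  have "AE t in \<mu> k. norm (f t) \<le> B"
    using supp[of k] by eventually_elim (rule B)
  moreover have "f \<in> borel_measurable (\<mu> k)"
    using borel_measurable_continuous_onI[OF assms] by simp
  ultimately show ?thesis by (rule integrable_const_bound)
qed

lemma integral_poly_eq_moments:
  "(\<integral>x. poly p x \<partial>\<mu> k) = (\<Sum>i\<le>degree p. coeff p i * (\<integral>x. x ^ i \<partial>\<mu> k))"
  unfolding poly_altdef
  by (simp add: Bochner_Integration.integral_sum integrable_unit_supported continuous_intros)

text \<open>The system expressing Legendre means through moments is triangular with nonzero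
  diagonal, so the \<open>n\<close>-th moment converges once the lower ones do.\<close>

lemma moments_tendsto_if_legendre_tendsto:
  assumes leg: "\<And>m. m \<ge> 1 \<Longrightarrow> (\<lambda>k. \<integral>x. poly (shifted_legendre m) x \<partial>\<mu> k) \<longlonglongrightarrow> 0"
  shows "(\<lambda>k. \<integral>x. x ^ n \<partial>\<mu> k) \<longlonglongrightarrow> 1 / (real n + 1)"
proof (induction n rule: less_induct)
  case (less n)
  show ?case
  proof (cases "n = 0")
    case True
    have "measure (\<mu> k) (space (\<mu> k)) = 1" for k
      using distr[of k] by (simp add: real_distribution_def prob_space.prob_space)
    then show ?thesis using True by simp
  next
    case False
    let ?c = "coeff (shifted_legendre n)"
    have deg: "degree (shifted_legendre n) = n"
      using degree_shifted_legendre[of n] coeff_shifted_legendre_top[of n] le_degree[of "shifted_legendre n" n]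
      by force
    have split: "{..n} = insert n {..<n}" by auto
    have "(\<integral>x. poly (shifted_legendre n) x \<partial>\<mu> k)
       = ?c n * (\<integral>x. x ^ n \<partial>\<mu> k) + (\<Sum>i<n. ?c i * (\<integral>x. x ^ i \<partial>\<mu> k))" for k
      by (simp add: integral_poly_eq_moments deg split)
    then have mom: "(\<integral>x. x ^ n \<partial>\<mu> k)
       = ((\<integral>x. poly (shifted_legendre n) x \<partial>\<mu> k) - (\<Sum>i<n. ?c i * (\<integral>x. x ^ i \<partial>\<mu> k))) / ?c n" for k
      using coeff_shifted_legendre_top[of n] by simp
    have "(\<lambda>k. \<integral>x. x ^ n \<partial>\<mu> k) \<longlonglongrightarrow> (0 - (\<Sum>i<n. ?c i * (1 / (real i + 1)))) / ?c n"
      unfolding mom using False coeff_shifted_legendre_top[of n]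
      by (intro tendsto_intros leg less.IH) auto
    \<comment> \<open>This identifies the limit: Lebesgue measure has moments
      \<open>1 / (i + 1)\<close> and obeys the same linear relation, with Legendre mean 0.\<close>
    moreover have "integral {0..1} (poly (shifted_legendre n)) = (\<Sum>i\<le>n. ?c i * (1 / (real i + 1)))"
    proof -
      have "integral {0..1} (poly (shifted_legendre n)) = (\<Sum>i\<le>n. ?c i * integral {0..1} (\<lambda>t. t ^ i))"
        unfolding poly_altdef deg
        by (simp add: Henstock_Kurzweil_Integration.integral_sum integrable_continuous_interval continuous_intros)
      then show ?thesis
        using binomial_times_integral[of _ 0] by (simp add: add_ac)
    qed
    then have "(0 - (\<Sum>i<n. ?c i * (1 / (real i + 1)))) / ?c n = 1 / (real n + 1)"
      using integral_shifted_legendre[of n] False coeff_shifted_legendre_top[of n]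
      by (simp add: split field_simps)
    ultimately show ?thesis by simp
  qed
qed

text \<open>Moments control integrals of polynomials, and by Stone-Weierstrass these approximate a
  continuous function uniformly on \<open>[0, 1]\<close>, which carries all the mass. Three errors
  of size \<open>e / 3\<close> add up.\<close>

lemma weak_conv_unit_interval_if_moments_tendsto:
  assumes mom: "\<And>n. (\<lambda>k. \<integral>x. x ^ n \<partial>\<mu> k) \<longlonglongrightarrow> 1 / (real n + 1)"
  shows "weak_conv_m \<mu> unit_interval_measure"
proof (rule integral_bdd_continuous_conv_imp_weak_conv)
  show "real_distribution (\<mu> k)" for k by (rule distr)
  show "real_distribution unit_interval_measure"
    by (simp add: real_distribution_def real_distribution_axioms_def prob_space_unit_interval)
  fix f :: "real \<Rightarrow> real"
  assume "\<And>x. isCont f x"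
  then have f: "continuous_on UNIV f" by (simp add: continuous_at_imp_continuous_on)
  show "(\<lambda>k. \<integral>x. f x \<partial>\<mu> k) \<longlonglongrightarrow> (\<integral>x. f x \<partial>unit_interval_measure)"
  proof (rule LIMSEQ_I)
    fix e :: real assume "e > 0"
    then obtain g where g: "real_polynomial_function g" "\<And>x. x \<in> {0..1} \<Longrightarrow> \<bar>f x - g x\<bar> < e / 3"
      using Stone_Weierstrass_real_polynomial_function[of "{0..1}" f "e / 3"] f
      by (metis compact_Icc continuous_on_subset subset_UNIV zero_less_divide_iff zero_less_numeral)
    then obtain a N where gs: "g = (\<lambda>x. \<Sum>i\<le>N. a i * x ^ i)"
      by (auto simp: real_polynomial_function_iff_sum)
    have gc: "continuous_on UNIV g" unfolding gs by (intro continuous_intros)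
    have close: "\<bar>(\<integral>x. f x \<partial>M) - (\<integral>x. g x \<partial>M)\<bar> \<le> e / 3"
      if "prob_space M" "AE x in M. x \<in> {0..1}" "integrable M f" "integrable M g" for M
    proof -
      interpret prob_space M by fact
      have "\<bar>(\<integral>x. f x \<partial>M) - (\<integral>x. g x \<partial>M)\<bar> = \<bar>\<integral>x. f x - g x \<partial>M\<bar>"
        using that by simp
      also have "\<dots> \<le> (\<integral>x. \<bar>f x - g x\<bar> \<partial>M)"
        by (rule integral_abs_bound)
      also have "\<dots> \<le> (\<integral>x. e / 3 \<partial>M)"
      proof (rule integral_mono_AE)
        show "AE x in M. \<bar>f x - g x\<bar> \<le> e / 3"
          using that(2) by eventually_elim (rule less_imp_le[OF g(2)])
      qed (use that in auto)
      finally show ?thesis by (simp add: prob_space)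
    qed
    have "(\<integral>x. g x \<partial>\<mu> k) = (\<Sum>i\<le>N. a i * (\<integral>x. x ^ i \<partial>\<mu> k))" for k
      unfolding gs
      by (simp add: Bochner_Integration.integral_sum integrable_unit_supported continuous_intros)
    moreover have "(\<lambda>k. \<Sum>i\<le>N. a i * (\<integral>x. x ^ i \<partial>\<mu> k)) \<longlonglongrightarrow> (\<Sum>i\<le>N. a i * (1 / (real i + 1)))"
      by (intro tendsto_sum tendsto_mult tendsto_const mom)
    moreover have "(\<integral>x. g x \<partial>unit_interval_measure) = (\<Sum>i\<le>N. a i * (1 / (real i + 1)))"
    proof -
      have "(\<integral>x. x ^ i \<partial>unit_interval_measure) = 1 / (real i + 1)" for i
        using binomial_times_integral[of i 0]
        by (simp add: integral_unit_interval continuous_intros add_ac)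
      then show ?thesis
        unfolding gs by (simp add: Bochner_Integration.integral_sum integrable_unit_interval continuous_intros)
    qed
    ultimately have "(\<lambda>k. \<integral>x. g x \<partial>\<mu> k) \<longlonglongrightarrow> (\<integral>x. g x \<partial>unit_interval_measure)"
      by simp
    then obtain K where K: "\<And>k. k \<ge> K \<Longrightarrow> \<bar>(\<integral>x. g x \<partial>\<mu> k) - (\<integral>x. g x \<partial>unit_interval_measure)\<bar> < e / 3"
      using LIMSEQ_D[of "\<lambda>k. \<integral>x. g x \<partial>\<mu> k" _ "e / 3"] \<open>e > 0\<close> unfolding real_norm_def
      by (metis divide_pos_pos zero_less_numeral)
    have unif: "\<bar>(\<integral>x. f x \<partial>unit_interval_measure) - (\<integral>x. g x \<partial>unit_interval_measure)\<bar> \<le> e / 3"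
      by (intro close prob_space_unit_interval integrable_unit_interval f gc AE_uniform_measureI) auto
    have "norm ((\<integral>x. f x \<partial>\<mu> k) - (\<integral>x. f x \<partial>unit_interval_measure)) < e" if "k \<ge> K" for k
    proof -
      have "\<bar>(\<integral>x. f x \<partial>\<mu> k) - (\<integral>x. g x \<partial>\<mu> k)\<bar> \<le> e / 3"
        using distr[of k] by (intro close supp integrable_unit_supported f gc) (simp add: real_distribution_def)
      with K[OF that] unif show ?thesis by (simp add: abs_if split: if_splits)
    qed
    then show "\<exists>K. \<forall>k\<ge>K. norm ((\<integral>x. f x \<partial>\<mu> k) - (\<integral>x. f x \<partial>unit_interval_measure)) < e"
      by blast
  qed
qed

end

section \<open>The law of the normalised squared modulus and its limit\<close>

definition rs_distr :: "nat \<Rightarrow> real measure" where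
  "rs_distr k = distr circle_measure borel (\<lambda>z. (cmod (poly (RS_P k) z) / sqrt (2 ^ (k + 1))) ^ 2)"

lemma rs_distr_eq:
  "rs_distr k = distr unit_interval_measure borel
     (\<lambda>t. (cmod (poly (RS_P k) (cis (2 * pi * t))) / sqrt (2 ^ (k + 1))) ^ 2)"
proof -
  have "(\<lambda>z. (cmod (poly (RS_P k) z) / sqrt (2 ^ (k + 1))) ^ 2) \<in> borel_measurable borel"
    by (intro borel_measurable_continuous_onI continuous_intros) auto
  moreover have "(\<lambda>t. cis (2 * pi * t)) \<in> borel_measurable unit_interval_measure"
    by (intro borel_measurable_unit_interval continuous_intros)
  ultimately show ?thesis
    unfolding rs_distr_def circle_measure_def by (subst distr_distr) (auto simp: o_def)
qed

lemma rs_statistic_borel_unit_interval: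
  "(\<lambda>t. (cmod (poly (RS_P k) (cis (2 * pi * t))) / sqrt (2 ^ (k + 1))) ^ 2)
     \<in> borel_measurable unit_interval_measure"
  by (intro borel_measurable_unit_interval continuous_intros) auto

lemma real_distribution_rs_distr: "real_distribution (rs_distr k)"
  unfolding real_distribution_def real_distribution_axioms_def rs_distr_eq
  using prob_space.prob_space_distr[OF prob_space_unit_interval rs_statistic_borel_unit_interval]
  by simp

lemma AE_rs_distr: "AE x in rs_distr k. x \<in> {0..1}"
proof -
  have "(cmod (poly (RS_P k) z) / sqrt (2 ^ (k + 1))) ^ 2 \<le> 1" if "cmod z = 1" for z
  proof -
    have "(cmod (poly (RS_P k) z))\<^sup>2 \<le> 2 ^ (k + 1)"
      unfolding RS_norm_sum[OF that, of k, symmetric] by simp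
    then show ?thesis by (simp add: power_divide)
  qed
  then show ?thesis
    unfolding rs_distr_eq by (subst AE_distr_iff[OF rs_statistic_borel_unit_interval]) auto
qed

text \<open>For \<open>h = m\<close> the character in \<open>rs_fourier\<close> is 1, so the mean of
  the middle coefficient is the Legendre mean.\<close>

lemma rs_distr_legendre_tendsto_0:
  assumes "m \<ge> 1"
  shows "(\<lambda>k. \<integral>x. poly (shifted_legendre m) x \<partial>rs_distr k) \<longlonglongrightarrow> 0"
proof -
  let ?T = "\<lambda>k t. (cmod (poly (RS_P k) (cis (2 * pi * t))) / sqrt (2 ^ (k + 1))) ^ 2"
  have "rs_fourier m k (int m) m = of_real (\<integral>x. poly (shifted_legendre m) x \<partial>rs_distr k)" for k
  proof -
    have "rs_fourier m k (int m) m
          = (\<integral>t. complex_of_real (poly (shifted_legendre m) (?T k t)) \<partial>unit_interval_measure)"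
      by (simp add: rs_fourier_def coeff_rs_form_middle)
    also have "\<dots> = of_real (\<integral>t. poly (shifted_legendre m) (?T k t) \<partial>unit_interval_measure)"
      by (rule integral_complex_of_real)
    also have "(\<integral>t. poly (shifted_legendre m) (?T k t) \<partial>unit_interval_measure)
               = (\<integral>x. poly (shifted_legendre m) x \<partial>rs_distr k)"
      unfolding rs_distr_eq
      by (rule integral_distr[OF rs_statistic_borel_unit_interval, symmetric])
         (intro borel_measurable_continuous_onI continuous_intros)
    finally show ?thesis .
  qed
  with rs_fourier_tendsto_0[OF assms] show ?thesis
    by (simp add: tendsto_of_real_iff[where c = 0, simplified])
qed


theorem mainTheorem1:
  shows "(\<forall>n::nat.
            (\<lambda>k. \<integral>z. (cmod (poly (RS_P k) z) / sqrt (2 ^ (k + 1))) ^ (2 * n) \<partial>circle_measure)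
              \<longlonglongrightarrow> 1 / (real n + 1))
       \<and> (\<forall>\<alpha> \<beta> :: real. 0 \<le> \<alpha> \<and> \<alpha> < \<beta> \<and> \<beta> \<le> 1 \<longrightarrow>
            (\<lambda>k. measure circle_measure
                   {z \<in> space circle_measure.
                      (cmod (poly (RS_P k) z) / sqrt (2 ^ (k + 1))) ^ 2 \<in> {\<alpha>..\<beta>}})
              \<longlonglongrightarrow> \<beta> - \<alpha>)"
proof (intro conjI allI impI)
  have meas: "(\<lambda>z. (cmod (poly (RS_P k) z) / sqrt (2 ^ (k + 1))) ^ 2) \<in> borel_measurable circle_measure" for k
    unfolding circle_measure_def measurable_distr_eq1
    by (intro borel_measurable_continuous_onI continuous_intros) auto
  have moments: "(\<lambda>k. \<integral>x. x ^ n \<partial>rs_distr k) \<longlonglongrightarrow> 1 / (real n + 1)" for n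
    by (intro moments_tendsto_if_legendre_tendsto real_distribution_rs_distr AE_rs_distr
          rs_distr_legendre_tendsto_0)
  then show "(\<lambda>k. \<integral>z. (cmod (poly (RS_P k) z) / sqrt (2 ^ (k + 1))) ^ (2 * n) \<partial>circle_measure)
              \<longlonglongrightarrow> 1 / (real n + 1)" for n
    unfolding rs_distr_def power_mult by (subst (asm) integral_distr[OF meas]) auto
  have weak: "weak_conv_m rs_distr unit_interval_measure"
    by (intro weak_conv_unit_interval_if_moments_tendsto real_distribution_rs_distr AE_rs_distr moments)
  fix \<alpha> \<beta> :: real assume ab: "0 \<le> \<alpha> \<and> \<alpha> < \<beta> \<and> \<beta> \<le> 1"
  have "real_distribution unit_interval_measure"
    by (simp add: real_distribution_def real_distribution_axioms_def prob_space_unit_interval)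
  \<comment> \<open>Weak convergence passes to sets whose boundary is null for the limit
    measure.\<close>
  moreover have "emeasure unit_interval_measure (frontier {\<alpha>..\<beta>}) = 0"
  proof -
    have "emeasure lborel ({0..<1} \<inter> {\<alpha>, \<beta>}) = 0"
      by (intro emeasure_lborel_countable) auto
    moreover have "frontier {\<alpha>..\<beta>} = {\<alpha>, \<beta>}"
      using ab by (auto simp: frontier_def)
    ultimately show ?thesis by (simp only: emeasure_uniform_measure) simp
  qed
  ultimately have "(\<lambda>k. measure (rs_distr k) {\<alpha>..\<beta>}) \<longlonglongrightarrow> measure unit_interval_measure {\<alpha>..\<beta>}"
    by (intro weak_conv_imp_continuity_set_conv[OF real_distribution_rs_distr _ weak]) auto
  moreover have "measure unit_interval_measure {\<alpha>..\<beta>} = \<beta> - \<alpha>"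
  proof -
    \<comment> \<open>The interval \<open>{0..<1}\<close> omits the null point 1, which matters when
      \<open>\<beta> = 1\<close>.\<close>
    have "emeasure lborel ({0..<1} \<inter> {\<alpha>..\<beta>}) = emeasure lborel {\<alpha>..\<beta>}"
      using AE_lborel_singleton[of 1] ab by (intro emeasure_eq_AE) (auto elim!: eventually_mono)
    then show ?thesis using ab by (simp add: measure_def emeasure_uniform_measure divide_ennreal_def)
  qed
  moreover have "measure (rs_distr k) {\<alpha>..\<beta>} = measure circle_measure {z \<in> space circle_measure.
                      (cmod (poly (RS_P k) z) / sqrt (2 ^ (k + 1))) ^ 2 \<in> {\<alpha>..\<beta>}}" for k
    unfolding rs_distr_def by (subst measure_distr[OF meas]) (auto intro!: arg_cong[where f = "measure circle_measure"])
  ultimately show "(\<lambda>k. measure circle_measure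
                   {z \<in> space circle_measure.
                      (cmod (poly (RS_P k) z) / sqrt (2 ^ (k + 1))) ^ 2 \<in> {\<alpha>..\<beta>}})
              \<longlonglongrightarrow> \<beta> - \<alpha>"
    by simp
qed

end
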